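(* Let $p,q\ge1$ be integers, let $t\in\mathbb{R}$, $x=(x^1,\dots,x^p)\in\mathbb{R}^p$, $u=(u^1,\dots,u^q)^T$ with $u^i=u^i(x,t)$, and let $K=(K_1,\dots,K_q)^T\in\mathcal{A}^q$. Let $\sigma=(\sigma_1,\dots,\sigma_q)^T\in\mathcal{B}^q$ be a symmetry and $\rho=(\rho_1,\dots,\rho_q)^T\in\mathcal{B}^q$ an adjoint symmetry of the system of evolution equations $u_t=K(u)$. Then, for all solutions $u$ of $u_t=K(u)$, $$ (\sigma^T\rho)_t=\Big(\sum_{i=1}^q\sigma_i\rho_i\Big)_t=\sum_{k=1}^p\partial_kX_k, $$ where, for $1\le k\le p$, $$ X_k=\sum_{i,j=1}^q\ \sum_{\alpha\ge0}\ \sum_{\beta_k=0}^{\alpha_k-1}\Big((-\partial_1)^{\alpha_1}\cdots(-\partial_{k-1})^{\alpha_{k-1}}(-\partial_k)^{\beta_k}\Big(\rho_i\frac{\partial K_i}{\partial u^j_\alpha}\Big)\Big)\Big(\partial_k^{\alpha_k-\beta_k-1}\partial_{k+1}^{\alpha_{k+1}}\cdots\partial_p^{\alpha_p}\sigma_j\Big). $$ Here $\alpha=(\alpha_1,\dots,\alpha_p)$ ranges over multi-indices of non-negative integers, an empty sum is zero, and an empty product of derivatives is the identity operator. Therefore $T=\sigma^T\rho$ is a conserved density of $u_t=K(u)$, and $X=(X_1,\dots,X_p)^T\in\mathcal{B}^p$ is the conserved flux vector corresponding to $T$.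
   Context: Notation. $\partial_j=\partial/\partial x^j$ denotes (total) differentiation with respect to the spatial variable $x^j$, and a subscript $t$ denotes total differentiation with respect to $t$. For a multi-index $\alpha=(\alpha_1,\dots,\alpha_p)$ of non-negative integers (written $\alpha\ge0$), $D^\alpha=\partial_1^{\alpha_1}\cdots\partial_p^{\alpha_p}$, $(-D)^\alpha=(-\partial_1)^{\alpha_1}\cdots(-\partial_p)^{\alpha_p}$, and $u^i_\alpha=D^\alpha u^i$. $\mathcal{A}$ is the space of all functions $f(x,u,\dots,u^{(n)})$, $n\ge0$, with $f$ smooth in the variables involved, where $u^{(n)}$ is the set of $n$-th order partial derivatives of $u$ with respect to $x$. $\mathcal{B}$ is the space of smooth functions of the independent variables, $u$ and derivatives of $u$ to some finite order, where explicit dependence on $t$ and nonlocal dependence on $u$ are also allowed; thus an element of $\mathcal{B}$ assigns to a smooth $u$ a smooth function of $(x,t)$. $\mathcal{A}^r,\mathcal{B}^r$ denote $r$-component column vectors with entries in $\mathcal{A}$, $\mathcal{B}$. The Gateaux operator of $K\in\mathcal{A}^q$ is the $q\times q$ matrix differential operator $K'=K'(u)$ with $(i,j)$ entry $\sum_{\alpha\ge0}\frac{\partial K_i}{\partial u^j_\alpha}D^\alpha$. Its adjoint $(K')^*$ is given by $((K')^*\rho)_j=\sum_{i=1}^q\sum_{\alpha\ge0}(-D)^\alpha\big(\frac{\partial K_i}{\partial u^j_\alpha}\rho_i\big)$. $\sigma\in\mathcal{B}^q$ is a symmetry of $u_t=K(u)$ if $(\sigma(u))_t=K'(u)\sigma(u)$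 whenever $u$ solves $u_t=K(u)$. $\rho\in\mathcal{B}^q$ is an adjoint symmetry of $u_t=K(u)$ if $(\rho(u))_t=-(K')^*(u)\rho(u)$ whenever $u$ solves $u_t=K(u)$. If a relation $T_t=\sum_{i=1}^p\partial_iX_i$ with $T,X_i\in\mathcal{B}$ holds for all solutions of $u_t=K(u)$, it is called a conservation law of $u_t=K(u)$, $T$ is called a conserved density, and $X=(X_1,\dots,X_p)^T$ a conserved flux vector corresponding to $T$. *)

theory Defs
  imports "HOL-Analysis.Analysis" "HOL-Library.Groups_Big_Fun"
begin

text \<open>
  The index type \<open>'p\<close> (finite and linearly ordered, so that its elements play the role of
  \<open>1 < \<dots> < p\<close>) indexes the spatial variables and \<open>'q\<close> the unknowns; both are nonempty, i.e.
  \<open>p, q \<ge> 1\<close>.  A scalar field is a function of \<open>(x, t)\<close>; \<open>u\<close> is the column of the fields \<open>u $ i\<close>.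
\<close>

type_synonym 'p spacetime = "(real ^ 'p) \<times> real"

type_synonym 'p field = "'p spacetime \<Rightarrow> real"

type_synonym ('p, 'q) fields = "('p field) ^ 'q"


subsection \<open>Smooth fields and their derivatives\<close>

text \<open>In finite dimension it makes no difference that the continuity of the derivative is
  required direction by direction.\<close>

primrec C_times :: "nat \<Rightarrow> ('a::real_normed_vector \<Rightarrow> real) \<Rightarrow> bool" where
  "C_times 0 f \<longleftrightarrow> continuous_on UNIV f"
| "C_times (Suc n) f \<longleftrightarrow> (\<forall>z. f differentiable (at z)) \<and>
     (\<forall>v. C_times n (\<lambda>z. frechet_derivative f (at z) v))"

definition smooth :: "('a::real_normed_vector \<Rightarrow> real) \<Rightarrow> bool" where
  "smooth f \<longleftrightarrow> (\<forall>n. C_times n f)"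

definition smooth_fields :: "('p::finite, 'q::finite) fields \<Rightarrow> bool" where
  "smooth_fields u \<longleftrightarrow> (\<forall>i. smooth (u $ i))"

definition dx :: "'p::finite \<Rightarrow> 'p field \<Rightarrow> 'p field" where
  "dx k f = (\<lambda>(x, t). deriv (\<lambda>s. f (x + s *\<^sub>R axis k 1, t)) 0)"

definition dt :: "'p::finite field \<Rightarrow> 'p field" where
  "dt f = (\<lambda>(x, t). deriv (\<lambda>s. f (x, s)) t)"

definition mdx :: "'p::finite \<Rightarrow> 'p field \<Rightarrow> 'p field" where
  "mdx k f = (\<lambda>z. - dx k f z)"

text \<open>If \<open>S\<close> consists of \<open>k\<^sub>1 < \<dots> < k\<^sub>m\<close>, then \<open>ordered_diff d S \<alpha>\<close> is the composition
  \<open>d\<^sub>k\<^sub>1\<^bsup>\<alpha> k\<^sub>1\<^esup> \<circ> \<dots> \<circ> d\<^sub>k\<^sub>m\<^bsup>\<alpha> k\<^sub>m\<^esup>\<close>, and the identity if \<open>S\<close> is empty.\<close>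

definition ordered_diff ::
  "('p::{finite,linorder} \<Rightarrow> 'p field \<Rightarrow> 'p field) \<Rightarrow> 'p set \<Rightarrow> ('p \<Rightarrow> nat) \<Rightarrow> 'p field \<Rightarrow> 'p field"
  where "ordered_diff d S \<alpha> f = foldr (\<lambda>k. d k ^^ \<alpha> k) (sorted_list_of_set S) f"

abbreviation D_op :: "('p::{finite,linorder} \<Rightarrow> nat) \<Rightarrow> 'p field \<Rightarrow> 'p field" where
  "D_op \<alpha> \<equiv> ordered_diff dx UNIV \<alpha>"

abbreviation mD_op :: "('p::{finite,linorder} \<Rightarrow> nat) \<Rightarrow> 'p field \<Rightarrow> 'p field" where
  "mD_op \<alpha> \<equiv> ordered_diff mdx UNIV \<alpha>"


subsection \<open>Differential functions\<close>

text \<open>\<open>Xvar k\<close> stands for \<open>x\<^sup>k\<close> and \<open>Uvar j \<alpha>\<close> for \<open>u\<^sup>j\<^sub>\<alpha>\<close>.  There is no variable for \<open>t\<close>.\<close>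

datatype ('p, 'q) jet_var = Xvar 'p | Uvar 'q "'p \<Rightarrow> nat"

type_synonym ('p, 'q) jet_fun = "(('p, 'q) jet_var \<Rightarrow> real) \<Rightarrow> real"

definition pdiff :: "('p, 'q) jet_var \<Rightarrow> ('p, 'q) jet_fun \<Rightarrow> ('p, 'q) jet_fun" where
  "pdiff v f = (\<lambda>y. deriv (\<lambda>s. f (y(v := s))) (y v))"

text \<open>All iterated partial derivatives exist and are continuous.  Continuity refers to the product
  topology; for a function of finitely many of the variables this is joint continuity in them.\<close>

definition smooth_jet :: "('p, 'q) jet_fun \<Rightarrow> bool" where
  "smooth_jet f \<longleftrightarrow> (\<forall>vs. continuous_on UNIV (foldr pdiff vs f) \<and>
     (\<forall>v y. (\<lambda>s. foldr pdiff vs f (y(v := s))) differentiable (at (y v))))"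

definition of_order_le :: "nat \<Rightarrow> ('p::finite, 'q) jet_fun \<Rightarrow> bool" where
  "of_order_le n f \<longleftrightarrow> (\<forall>y y'. (\<forall>k. y (Xvar k) = y' (Xvar k)) \<and>
     (\<forall>j \<alpha>. (\<Sum>k\<in>UNIV. \<alpha> k) \<le> n \<longrightarrow> y (Uvar j \<alpha>) = y' (Uvar j \<alpha>)) \<longrightarrow> f y = f y')"

definition space_A :: "('p::finite, 'q) jet_fun set" where
  "space_A = {f. smooth_jet f \<and> (\<exists>n. of_order_le n f)}"

definition jet :: "('p::{finite,linorder}, 'q::finite) fields \<Rightarrow> 'p spacetime \<Rightarrow>
    ('p, 'q) jet_var \<Rightarrow> real" where
  "jet u z v = (case v of Xvar k \<Rightarrow> fst z $ k | Uvar j \<alpha> \<Rightarrow> D_op \<alpha> (u $ j) z)"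

definition along :: "('p::{finite,linorder}, 'q::finite) jet_fun \<Rightarrow> ('p, 'q) fields \<Rightarrow> 'p field" where
  "along f u = (\<lambda>z. f (jet u z))"

text \<open>Elements of \<open>\<B>\<close> may depend on \<open>t\<close> explicitly and on \<open>u\<close> nonlocally: they are the
  operators taking smooth \<open>u\<close> to smooth functions of \<open>(x, t)\<close>.\<close>

type_synonym ('p, 'q) field_op = "('p, 'q) fields \<Rightarrow> 'p field"

definition space_B :: "('p::finite, 'q::finite) field_op set" where
  "space_B = {T. \<forall>u. smooth_fields u \<longrightarrow> smooth (T u)}"

definition values_at :: "(('p, 'q) field_op) ^ 'r \<Rightarrow> ('p, 'q) fields \<Rightarrow> ('p, 'r) fields" where
  "values_at \<sigma> u = (\<chi> i. (\<sigma> $ i) u)"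


subsection \<open>Gateaux operators, symmetries and adjoint symmetries\<close>

text \<open>The sums over all multi-indices are finite sums, as only finitely many
  \<open>\<partial>K\<^sub>i/\<partial>u\<^sup>j\<^sub>\<alpha>\<close> do not vanish for \<open>K\<^sub>i \<in> \<A>\<close>; \<open>Sum_any\<close> sums over the support of the summand.\<close>

definition gateaux :: "(('p::{finite,linorder}, 'q::finite) jet_fun) ^ 'q \<Rightarrow> ('p, 'q) fields \<Rightarrow>
    ('p field \<Rightarrow> 'p field) ^ 'q ^ 'q" where
  "gateaux K u = (\<chi> i j. (\<lambda>f z.
     Sum_any (\<lambda>\<alpha>. along (pdiff (Uvar j \<alpha>) (K $ i)) u z * D_op \<alpha> f z)))"

definition apply_matrix :: "('p field \<Rightarrow> 'p field) ^ 'q::finite ^ 'r \<Rightarrow>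
    ('p, 'q) fields \<Rightarrow> ('p, 'r) fields" where
  "apply_matrix L w = (\<chi> i. (\<lambda>z. \<Sum>j\<in>UNIV. (L $ i $ j) (w $ j) z))"

definition gateaux_adjoint :: "(('p::{finite,linorder}, 'q::finite) jet_fun) ^ 'q \<Rightarrow>
    ('p, 'q) fields \<Rightarrow> ('p, 'q) fields \<Rightarrow> ('p, 'q) fields" where
  "gateaux_adjoint K u w = (\<chi> j. (\<lambda>z. \<Sum>i\<in>UNIV.
     Sum_any (\<lambda>\<alpha>. mD_op \<alpha> (\<lambda>z'. along (pdiff (Uvar j \<alpha>) (K $ i)) u z' * (w $ i) z') z)))"

definition solution :: "(('p::{finite,linorder}, 'q::finite) jet_fun) ^ 'q \<Rightarrow>
    ('p, 'q) fields \<Rightarrow> bool" where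
  "solution K u \<longleftrightarrow> smooth_fields u \<and> (\<forall>i z. dt (u $ i) z = along (K $ i) u z)"

definition is_symmetry :: "(('p::{finite,linorder}, 'q::finite) jet_fun) ^ 'q \<Rightarrow>
    (('p, 'q) field_op) ^ 'q \<Rightarrow> bool" where
  "is_symmetry K \<sigma> \<longleftrightarrow> (\<forall>i. \<sigma> $ i \<in> space_B) \<and>
     (\<forall>u. solution K u \<longrightarrow>
        (\<forall>i z. dt ((\<sigma> $ i) u) z = (apply_matrix (gateaux K u) (values_at \<sigma> u) $ i) z))"

definition is_adjoint_symmetry :: "(('p::{finite,linorder}, 'q::finite) jet_fun) ^ 'q \<Rightarrow>
    (('p, 'q) field_op) ^ 'q \<Rightarrow> bool" where
  "is_adjoint_symmetry K \<rho> \<longleftrightarrow> (\<forall>i. \<rho> $ i \<in> space_B) \<and>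
     (\<forall>u. solution K u \<longrightarrow>
        (\<forall>i z. dt ((\<rho> $ i) u) z = - (gateaux_adjoint K u (values_at \<rho> u) $ i) z))"


subsection \<open>Conservation laws\<close>

definition conservation_law :: "(('p::{finite,linorder}, 'q::finite) jet_fun) ^ 'q \<Rightarrow>
    ('p, 'q) field_op \<Rightarrow> (('p, 'q) field_op) ^ ('p::{finite,linorder}) \<Rightarrow> bool" where
  "conservation_law K T X \<longleftrightarrow> T \<in> space_B \<and> (\<forall>k. X $ k \<in> space_B) \<and>
     (\<forall>u. solution K u \<longrightarrow> (\<forall>z. dt (T u) z = (\<Sum>k\<in>UNIV. dx k ((X $ k) u) z)))"

definition conserved_density :: "(('p::{finite,linorder}, 'q::finite) jet_fun) ^ 'q \<Rightarrow>
    ('p, 'q) field_op \<Rightarrow> bool" where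
  "conserved_density K T \<longleftrightarrow> (\<exists>X. conservation_law K T X)"

definition conserved_flux :: "(('p::{finite,linorder}, 'q::finite) jet_fun) ^ 'q \<Rightarrow>
    ('p, 'q) field_op \<Rightarrow> (('p, 'q) field_op) ^ ('p::{finite,linorder}) \<Rightarrow> bool" where
  "conserved_flux K T X \<longleftrightarrow> conservation_law K T X"

definition inner_op :: "(('p, 'q::finite) field_op) ^ 'q \<Rightarrow> (('p, 'q) field_op) ^ 'q \<Rightarrow>
    ('p, 'q) field_op" where
  "inner_op \<sigma> \<rho> = (\<lambda>u z. \<Sum>i\<in>UNIV. (\<sigma> $ i) u z * (\<rho> $ i) u z)"

definition flux :: "(('p::{finite,linorder}, 'q::finite) jet_fun) ^ 'q \<Rightarrow>
    (('p, 'q) field_op) ^ 'q \<Rightarrow> (('p, 'q) field_op) ^ 'q \<Rightarrow> (('p, 'q) field_op) ^ ('p::{finite,linorder})" where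
  "flux K \<sigma> \<rho> = (\<chi> k. (\<lambda>u z. \<Sum>i\<in>UNIV. \<Sum>j\<in>UNIV. Sum_any (\<lambda>\<alpha>. \<Sum>\<beta><\<alpha> k.
     ordered_diff mdx {..<k} \<alpha>
       ((mdx k ^^ \<beta>) (\<lambda>z'. (\<rho> $ i) u z' * along (pdiff (Uvar j \<alpha>) (K $ i)) u z')) z *
     (dx k ^^ (\<alpha> k - \<beta> - 1)) (ordered_diff dx {k<..} \<alpha> ((\<sigma> $ j) u)) z)))"

end

theory Submission
  imports Defs
begin

text \<open>
  The time derivative of \<open>\<sigma>\<^sup>T \<rho>\<close> along a solution is \<open>\<rho>\<^sup>T (K' \<sigma>) - \<sigma>\<^sup>T ((K')\<^sup>* \<rho>)\<close>, so the theorem is the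
  Lagrange identity for \<open>K'\<close>.  For one term \<open>f \<cdot> D\<^sup>\<alpha> g - ((-D)\<^sup>\<alpha> f) \<cdot> g\<close> the derivatives are
  moved from \<open>g\<close> to \<open>f\<close> variable by variable, and each variable contributes one telescoping
  sum.  This needs the symmetry of mixed derivatives and the smoothness of
  \<open>\<partial>K\<^sub>i/\<partial>u\<^sup>j\<^sub>\<alpha>\<close> along \<open>u\<close>, which is a chain rule in finitely many jet variables.
\<close>

subsection \<open>Smooth functions\<close>

abbreviation dir_deriv :: "'a::real_normed_vector \<Rightarrow> ('a \<Rightarrow> real) \<Rightarrow> 'a \<Rightarrow> real" where
  "dir_deriv v f \<equiv> (\<lambda>z. frechet_derivative f (at z) v)"

text \<open>The recursion for \<open>C_times\<close> does not say that the classes are nested. At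
  the bottom this is continuity of differentiable functions. The product rule needs it, since there
  each factor also occurs undifferentiated.\<close>

lemma C_times_Suc_D: "C_times (Suc n) f \<Longrightarrow> C_times n f"
proof (induction n arbitrary: f)
  case 0
  then show ?case
    by (auto simp: continuous_on_eq_continuous_within
        intro: differentiable_imp_continuous_within)
next
  case (Suc n)
  then show ?case by auto
qed

lemma C_times_const: "C_times n (\<lambda>_. c)"
  by (induction n arbitrary: c) auto

lemma C_times_add: "C_times n f \<Longrightarrow> C_times n g \<Longrightarrow> C_times n (\<lambda>z. f z + g z)"
proof (induction n arbitrary: f g)
  case 0
  then show ?case by (simp add: continuous_on_add)
next
  case (Suc n)
  have "dir_deriv v (\<lambda>z. f z + g z) = (\<lambda>z. dir_deriv v f z + dir_deriv v g z)" for v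
  proof
    fix z
    from Suc.prems have "(f has_derivative frechet_derivative f (at z)) (at z)"
      "(g has_derivative frechet_derivative g (at z)) (at z)"
      by (auto simp: frechet_derivative_works)
    from frechet_derivative_at[OF has_derivative_add[OF this]]
    show "dir_deriv v (\<lambda>z. f z + g z) z = dir_deriv v f z + dir_deriv v g z"
      by metis
  qed
  with Suc show ?case by auto
qed

lemma C_times_mult: "C_times n f \<Longrightarrow> C_times n g \<Longrightarrow> C_times n (\<lambda>z. f z * g z)"
proof (induction n arbitrary: f g)
  case 0
  then show ?case by (simp add: continuous_on_mult)
next
  case (Suc n)
  have eq: "dir_deriv v (\<lambda>z. f z * g z) = (\<lambda>z. f z * dir_deriv v g z + dir_deriv v f z * g z)" for v
  proof
    fix z
    from Suc.prems have "(f has_derivative frechet_derivative f (at z)) (at z)"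
      "(g has_derivative frechet_derivative g (at z)) (at z)"
      by (auto simp: frechet_derivative_works)
    from frechet_derivative_at[OF has_derivative_mult[OF this]]
    show "dir_deriv v (\<lambda>z. f z * g z) z = f z * dir_deriv v g z + dir_deriv v f z * g z"
      by metis
  qed
  have "C_times n f" "C_times n g"
    using Suc.prems C_times_Suc_D by blast+
  with Suc.prems have "C_times n (dir_deriv v (\<lambda>z. f z * g z))" for v
    unfolding eq by (intro C_times_add Suc.IH) auto
  with Suc.prems show ?case by auto
qed

lemma C_times_sum: "(\<And>i. i \<in> I \<Longrightarrow> C_times n (f i)) \<Longrightarrow> C_times n (\<lambda>z. \<Sum>i\<in>I. f i z)"
  by (induction I rule: infinite_finite_induct) (auto intro: C_times_add C_times_const)

lemma smooth_const: "smooth (\<lambda>_. c)"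
  by (simp add: smooth_def C_times_const)

lemma smooth_mult: "smooth f \<Longrightarrow> smooth g \<Longrightarrow> smooth (\<lambda>z. f z * g z)"
  by (simp add: smooth_def C_times_mult)

lemma smooth_minus: "smooth f \<Longrightarrow> smooth (\<lambda>z. - f z)"
  using smooth_mult[OF smooth_const[of "-1"]] by simp

lemma smooth_sum: "(\<And>i. i \<in> I \<Longrightarrow> smooth (f i)) \<Longrightarrow> smooth (\<lambda>z. \<Sum>i\<in>I. f i z)"
  by (simp add: smooth_def C_times_sum)

lemma smooth_differentiable: "smooth f \<Longrightarrow> f differentiable (at z)"
  unfolding smooth_def using C_times.simps(2) by blast

lemma smooth_dir_deriv: "smooth f \<Longrightarrow> smooth (dir_deriv v f)"
  unfolding smooth_def using C_times.simps(2) by blast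

lemma smooth_isCont: "smooth f \<Longrightarrow> isCont f z"
  by (simp add: smooth_differentiable differentiable_imp_continuous_within)

lemma smooth_bounded_linear:
  assumes "bounded_linear f"
  shows "smooth f"
proof -
  have "dir_deriv v f = (\<lambda>z. f v)" for v
    using frechet_derivative_at[OF bounded_linear_imp_has_derivative[OF assms]] by metis
  moreover have "continuous_on UNIV f"
    using assms by (simp add: linear_continuous_on)
  ultimately have "C_times n f" for n
    using assms by (cases n) (auto simp: C_times_const bounded_linear_imp_differentiable)
  then show ?thesis by (simp add: smooth_def)
qed

section \<open>Restriction to lines and symmetry of second derivatives\<close>

lemma smooth_has_real_derivative_line:
  assumes "smooth f"
  shows "((\<lambda>s. f (a + s *\<^sub>R v)) has_real_derivative dir_deriv v f (a + s *\<^sub>R v)) (at s)"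
proof -
  let ?F = "frechet_derivative f (at (a + s *\<^sub>R v))"
  have f: "(f has_derivative ?F) (at (a + s *\<^sub>R v))"
    using smooth_differentiable[OF assms] by (simp add: frechet_derivative_works)
  have "((\<lambda>s. a + s *\<^sub>R v) has_derivative (\<lambda>h. h *\<^sub>R v)) (at s)"
    by (auto intro!: derivative_eq_intros)
  from has_derivative_compose[OF this f]
  have "((\<lambda>s. f (a + s *\<^sub>R v)) has_derivative (\<lambda>h. ?F (h *\<^sub>R v))) (at s)" .
  moreover have "(\<lambda>h. ?F (h *\<^sub>R v)) = (*) (?F v)"
    using linear_scale[OF linear_frechet_derivative[OF smooth_differentiable[OF assms]]]
    by (auto simp: mult.commute)
  ultimately show ?thesis
    by (simp add: has_field_derivative_def)
qed

text \<open>The mean value theorem is applied twice: first in direction \<open>v\<close> to the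
  difference of \<open>f\<close> along two parallel lines (\<open>\<phi>\<close>), then in direction
  \<open>w\<close> to the derivative so obtained (\<open>\<psi>\<close>). Each application
  contributes one factor \<open>s\<close>.\<close>

lemma second_difference_mvt:
  assumes "smooth f" and "s > 0"
  obtains \<xi> \<eta> where "0 < \<xi>" "\<xi> < s" "0 < \<eta>" "\<eta> < s"
    "f (z + s *\<^sub>R v + s *\<^sub>R w) - f (z + s *\<^sub>R v) - (f (z + s *\<^sub>R w) - f z)
       = s * s * dir_deriv w (dir_deriv v f) (z + \<xi> *\<^sub>R v + \<eta> *\<^sub>R w)"
proof -
  define \<phi> where "\<phi> = (\<lambda>r. f ((z + s *\<^sub>R w) + r *\<^sub>R v) - f (z + r *\<^sub>R v))"
  have d\<phi>: "(\<phi> has_real_derivative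
      dir_deriv v f ((z + s *\<^sub>R w) + r *\<^sub>R v) - dir_deriv v f (z + r *\<^sub>R v)) (at r)" for r
    unfolding \<phi>_def
    by (intro DERIV_diff smooth_has_real_derivative_line assms)
  obtain \<xi> where \<xi>: "0 < \<xi>" "\<xi> < s" "\<phi> s - \<phi> 0 = (s - 0) *
      (dir_deriv v f ((z + s *\<^sub>R w) + \<xi> *\<^sub>R v) - dir_deriv v f (z + \<xi> *\<^sub>R v))"
    using MVT2[OF \<open>s > 0\<close> d\<phi>] by blast
  define \<psi> where "\<psi> = (\<lambda>r. dir_deriv v f ((z + \<xi> *\<^sub>R v) + r *\<^sub>R w))"
  have d\<psi>: "(\<psi> has_real_derivative dir_deriv w (dir_deriv v f) ((z + \<xi> *\<^sub>R v) + r *\<^sub>R w)) (at r)" for r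
    unfolding \<psi>_def by (intro smooth_has_real_derivative_line smooth_dir_deriv assms)
  obtain \<eta> where \<eta>: "0 < \<eta>" "\<eta> < s"
    "\<psi> s - \<psi> 0 = (s - 0) * dir_deriv w (dir_deriv v f) ((z + \<xi> *\<^sub>R v) + \<eta> *\<^sub>R w)"
    using MVT2[OF \<open>s > 0\<close> d\<psi>] by blast
  have "\<phi> s - \<phi> 0 = s * (\<psi> s - \<psi> 0)"
    using \<xi>(3) by (simp add: \<psi>_def algebra_simps)
  with \<eta>(3) have "\<phi> s - \<phi> 0 = s * s * dir_deriv w (dir_deriv v f) (z + \<xi> *\<^sub>R v + \<eta> *\<^sub>R w)"
    by simp
  moreover have "\<phi> s - \<phi> 0 =
      f (z + s *\<^sub>R v + s *\<^sub>R w) - f (z + s *\<^sub>R v) - (f (z + s *\<^sub>R w) - f z)"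
    by (simp add: \<phi>_def algebra_simps)
  ultimately show ?thesis
    using that \<xi>(1,2) \<eta>(1,2) by metis
qed

text \<open>Schwarz's theorem. The second difference over the parallelogram spanned by
  \<open>s *\<^sub>R v\<close> and \<open>s *\<^sub>R w\<close> is symmetric in \<open>v\<close> and
  \<open>w\<close>, so the two mixed derivatives agree at two points that both tend to
  \<open>z\<close> as s tends to 0. Continuity of the second derivatives then gives equality at
  \<open>z\<close>.\<close>

lemma dir_deriv_commute:
  assumes "smooth f"
  shows "dir_deriv v (dir_deriv w f) = dir_deriv w (dir_deriv v f)"
proof
  fix z
  let ?A = "dir_deriv v (dir_deriv w f)" and ?B = "dir_deriv w (dir_deriv v f)"
  have "\<exists>\<xi> \<eta> \<xi>' \<eta>'. 0 < \<xi> \<and> \<xi> < s \<and> 0 < \<eta> \<and> \<eta> < s \<and> 0 < \<xi>' \<and> \<xi>' < s \<and> 0 < \<eta>' \<and> \<eta>' < s \<and>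
      ?A (z + \<xi> *\<^sub>R w + \<eta> *\<^sub>R v) = ?B (z + \<xi>' *\<^sub>R v + \<eta>' *\<^sub>R w)" if "s > 0" for s
  proof -
    obtain \<xi> \<eta> where 1: "0 < \<xi>" "\<xi> < s" "0 < \<eta>" "\<eta> < s"
      "f (z + s *\<^sub>R w + s *\<^sub>R v) - f (z + s *\<^sub>R w) - (f (z + s *\<^sub>R v) - f z)
       = s * s * ?A (z + \<xi> *\<^sub>R w + \<eta> *\<^sub>R v)"
      using second_difference_mvt[OF assms \<open>s > 0\<close>] by blast
    obtain \<xi>' \<eta>' where 2: "0 < \<xi>'" "\<xi>' < s" "0 < \<eta>'" "\<eta>' < s"
      "f (z + s *\<^sub>R v + s *\<^sub>R w) - f (z + s *\<^sub>R v) - (f (z + s *\<^sub>R w) - f z)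
       = s * s * ?B (z + \<xi>' *\<^sub>R v + \<eta>' *\<^sub>R w)"
      using second_difference_mvt[OF assms \<open>s > 0\<close>] by blast
    have "z + s *\<^sub>R v + s *\<^sub>R w = z + s *\<^sub>R w + s *\<^sub>R v" by simp
    from 1(5) 2(5)[unfolded this]
    have "s * s * ?A (z + \<xi> *\<^sub>R w + \<eta> *\<^sub>R v) = s * s * ?B (z + \<xi>' *\<^sub>R v + \<eta>' *\<^sub>R w)"
      by linarith
    with \<open>s > 0\<close> have "?A (z + \<xi> *\<^sub>R w + \<eta> *\<^sub>R v) = ?B (z + \<xi>' *\<^sub>R v + \<eta>' *\<^sub>R w)"
      by simp
    with 1(1-4) 2(1-4) show ?thesis by blast
  qed
  \<comment> \<open>The intermediate points become functions of the side length \<open>s\<close>;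
    lying between 0 and \<open>s\<close> is all that is needed for their limits.\<close>
  then obtain a b a' b' where ab: "\<And>s::real. s > 0 \<Longrightarrow> 0 < a s \<and> a s < s \<and> 0 < b s \<and> b s < s \<and>
      0 < a' s \<and> a' s < s \<and> 0 < b' s \<and> b' s < s \<and>
      ?A (z + a s *\<^sub>R w + b s *\<^sub>R v) = ?B (z + a' s *\<^sub>R v + b' s *\<^sub>R w)"
    by metis
  have pos: "\<forall>\<^sub>F s::real in at_right 0. s > 0"
    by (simp add: eventually_at_right_less)
  have squeeze: "(c \<longlongrightarrow> 0) (at_right 0)" if "\<And>s::real. s > 0 \<Longrightarrow> 0 < c s \<and> c s < s" for c
  proof (rule tendsto_sandwich[of "\<lambda>_. 0" _ _ "\<lambda>s. s"])
    show "\<forall>\<^sub>F s in at_right 0. 0 \<le> c s" "\<forall>\<^sub>F s in at_right 0. c s \<le> s"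
      using pos that by (auto elim!: eventually_mono intro: less_imp_le)
  qed (auto intro: tendsto_ident_at)
  have lims: "(a \<longlongrightarrow> 0) (at_right 0)" "(b \<longlongrightarrow> 0) (at_right 0)"
    "(a' \<longlongrightarrow> 0) (at_right 0)" "(b' \<longlongrightarrow> 0) (at_right 0)"
    using ab by (auto intro!: squeeze)
  have "((\<lambda>s. z + a s *\<^sub>R w + b s *\<^sub>R v) \<longlongrightarrow> z + 0 *\<^sub>R w + 0 *\<^sub>R v) (at_right 0)"
    "((\<lambda>s. z + a' s *\<^sub>R v + b' s *\<^sub>R w) \<longlongrightarrow> z + 0 *\<^sub>R v + 0 *\<^sub>R w) (at_right 0)"
    by (intro tendsto_intros lims)+
  then have "((\<lambda>s. z + a s *\<^sub>R w + b s *\<^sub>R v) \<longlongrightarrow> z) (at_right 0)"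
    "((\<lambda>s. z + a' s *\<^sub>R v + b' s *\<^sub>R w) \<longlongrightarrow> z) (at_right 0)"
    by simp_all
  then have A: "((\<lambda>s. ?A (z + a s *\<^sub>R w + b s *\<^sub>R v)) \<longlongrightarrow> ?A z) (at_right 0)"
    and B: "((\<lambda>s. ?B (z + a' s *\<^sub>R v + b' s *\<^sub>R w)) \<longlongrightarrow> ?B z) (at_right 0)"
    using smooth_isCont[OF smooth_dir_deriv[OF smooth_dir_deriv[OF assms]]]
    by (auto intro: isCont_tendsto_compose)
  have "\<forall>\<^sub>F s in at_right 0. ?B (z + a' s *\<^sub>R v + b' s *\<^sub>R w) = ?A (z + a s *\<^sub>R w + b s *\<^sub>R v)"
    using pos
  proof (rule eventually_mono)
    fix s :: real assume "s > 0"
    with ab show "?B (z + a' s *\<^sub>R v + b' s *\<^sub>R w) = ?A (z + a s *\<^sub>R w + b s *\<^sub>R v)"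
      by metis
  qed
  with B have "((\<lambda>s. ?A (z + a s *\<^sub>R w + b s *\<^sub>R v)) \<longlongrightarrow> ?B z) (at_right 0)"
    by (rule Lim_transform_eventually)
  with A show "?A z = ?B z"
    using tendsto_unique trivial_limit_at_right_real by blast
qed


subsection \<open>Total derivatives\<close>

text \<open>\<open>dx\<close> is defined by \<open>deriv\<close>, which is informative only where
  the derivative exists. Smoothness provides this, and the identification with a directional
  derivative carries smoothness and symmetry over to \<open>dx\<close>.\<close>

lemma smooth_has_dx:
  assumes "smooth f"
  shows "((\<lambda>s. f (fst z + s *\<^sub>R axis k 1, snd z)) has_real_derivative dx k f z) (at 0)"
    and "dx k f z = dir_deriv (axis k 1, 0) f z"
proof -
  have eq: "(\<lambda>s. f (z + s *\<^sub>R (axis k 1, 0))) = (\<lambda>s. f (fst z + s *\<^sub>R axis k 1, snd z))"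
    by (cases z) simp
  have "((\<lambda>s. f (fst z + s *\<^sub>R axis k 1, snd z)) has_real_derivative dir_deriv (axis k 1, 0) f z) (at 0)"
    using smooth_has_real_derivative_line[OF assms, of z "(axis k 1, 0)" 0]
    by (simp only: eq scaleR_zero_left add_0_right)
  moreover from DERIV_imp_deriv[OF this] show "dx k f z = dir_deriv (axis k 1, 0) f z"
    by (simp add: dx_def case_prod_beta)
  ultimately show "((\<lambda>s. f (fst z + s *\<^sub>R axis k 1, snd z)) has_real_derivative dx k f z) (at 0)"
    by simp
qed

lemma smooth_has_dt:
  assumes "smooth f"
  shows "((\<lambda>s. f (fst z, s)) has_real_derivative dt f z) (at (snd z))"
proof -
  \<comment> \<open>\<open>dt\<close> differentiates at the actual time rather than at 0, so the
    line starts at time 0 and is used at parameter \<open>snd z\<close>.\<close>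
  have eq: "(\<lambda>s. f ((fst z, 0) + s *\<^sub>R (0, 1))) = (\<lambda>s. f (fst z, s))"
    by simp
  have "((\<lambda>s. f (fst z, s)) has_real_derivative dir_deriv (0, 1) f z) (at (snd z))"
    using smooth_has_real_derivative_line[OF assms, of "(fst z, 0)" "(0, 1)" "snd z"] by (simp add: eq)
  moreover from DERIV_imp_deriv[OF this] have "dt f z = dir_deriv (0, 1) f z"
    by (simp add: dt_def case_prod_beta)
  ultimately show ?thesis by simp
qed

lemma smooth_dx: "smooth f \<Longrightarrow> smooth (dx k f)"
proof -
  assume f: "smooth f"
  then have "dx k f = dir_deriv (axis k 1, 0) f"
    using smooth_has_dx(2) by blast
  with f show ?thesis by (simp add: smooth_dir_deriv)
qed

lemma smooth_mdx: "smooth f \<Longrightarrow> smooth (mdx k f)"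
  by (simp add: mdx_def smooth_dx smooth_minus)

lemma dx_commute:
  assumes "smooth f"
  shows "dx j (dx k f) = dx k (dx j f)"
proof -
  have "dx i (dx l f) = dir_deriv (axis i 1, 0) (dir_deriv (axis l 1, 0) f)" for i l
  proof -
    have "dx l f = dir_deriv (axis l 1, 0) f"
      using smooth_has_dx(2)[OF assms] by blast
    then show ?thesis
      using smooth_has_dx(2)[OF smooth_dir_deriv[OF assms]] by auto
  qed
  then show ?thesis
    using dir_deriv_commute[OF assms] by simp
qed

lemma dx_minus: "smooth f \<Longrightarrow> dx k (\<lambda>z. - f z) z = - dx k f z"
  using DERIV_imp_deriv[OF DERIV_minus[OF smooth_has_dx(1)]] by (simp add: dx_def case_prod_beta)

lemma dx_mult:
  assumes "smooth f" "smooth g"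
  shows "dx k (\<lambda>z. f z * g z) z = dx k f z * g z + f z * dx k g z"
  using DERIV_imp_deriv[OF DERIV_mult[OF smooth_has_dx(1)[OF assms(1)] smooth_has_dx(1)[OF assms(2)]]]
  by (simp add: dx_def case_prod_beta mult.commute)

lemma dx_sum:
  assumes "\<And>i. i \<in> I \<Longrightarrow> smooth (f i)"
  shows "dx k (\<lambda>z. \<Sum>i\<in>I. f i z) z = (\<Sum>i\<in>I. dx k (f i) z)"
  using DERIV_imp_deriv[OF DERIV_sum[OF smooth_has_dx(1)[OF assms]]]
  by (simp add: dx_def case_prod_beta)

lemma mdx_commute: "smooth f \<Longrightarrow> mdx j (mdx k f) = mdx k (mdx j f)"
  using dx_commute[of f] by (auto simp: mdx_def fun_eq_iff dx_minus smooth_dx)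

lemma dt_inner:
  assumes "\<And>i. i \<in> I \<Longrightarrow> smooth (f i)" "\<And>i. i \<in> I \<Longrightarrow> smooth (g i)"
  shows "dt (\<lambda>z. \<Sum>i\<in>I. f i z * g i z) z = (\<Sum>i\<in>I. dt (f i) z * g i z + f i z * dt (g i) z)"
proof -
  have "((\<lambda>s. \<Sum>i\<in>I. f i (fst z, s) * g i (fst z, s)) has_real_derivative
      (\<Sum>i\<in>I. dt (f i) z * g i (fst z, snd z) + dt (g i) z * f i (fst z, snd z))) (at (snd z))"
    by (intro DERIV_sum DERIV_mult smooth_has_dt assms)
  from DERIV_imp_deriv[OF this] show ?thesis
    by (simp add: dt_def case_prod_beta mult.commute)
qed


subsection \<open>Differential functions along a field\<close>

lemma tendsto_fun_componentwise:
  fixes H :: "'a \<Rightarrow> 'v \<Rightarrow> real"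
  assumes "\<And>v. ((\<lambda>z. H z v) \<longlongrightarrow> l v) F"
  shows "(H \<longlongrightarrow> l) F"
proof -
  \<comment> \<open>Continuity in \<open>smooth_jet\<close> refers to the product topology, where
    convergence is convergence of every coordinate.\<close>
  have "limitin (product_topology (\<lambda>_. euclidean) UNIV) H l F"
    using assms by (simp add: limitin_componentwise)
  then show ?thesis
    by (simp add: euclidean_product_topology)
qed

text \<open>A product rule in which \<open>c\<close> merely has a limit at \<open>z0\<close>. This
  suffices because the other factor vanishes at \<open>z0\<close> and is differentiable there. In
  the application \<open>c\<close> is a partial derivative at a mean value point, so it has no
  evident derivative of its own.\<close>

lemma has_derivative_increment_times:
  fixes a c :: "'a::real_normed_vector \<Rightarrow> real"
  assumes a: "(a has_derivative a') (at z0)" and c: "(c \<longlongrightarrow> c0) (at z0)"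
  shows "((\<lambda>z. (a z - a z0) * c z) has_derivative (\<lambda>x. c0 * a' x)) (at z0)"
proof -
  have bl: "bounded_linear a'"
    using a by (rule has_derivative_bounded_linear)
  obtain B where B: "\<And>x. norm (a' x) \<le> norm x * B"
    using bounded_linear.bounded[OF bl] by blast
  let ?R = "\<lambda>z. norm (a z - a z0 - a' (z - z0)) / norm (z - z0)"
  have R: "(?R \<longlongrightarrow> 0) (at z0)"
    using a by (simp add: has_derivative_iff_norm)
  \<comment> \<open>The majorant comes from splitting the error into \<open>c\<close> times the
    remainder of \<open>a\<close> and \<open>c - c0\<close> times \<open>a'\<close>, the latter
    bounded by means of \<open>B\<close>.\<close>
  have lim: "((\<lambda>z. \<bar>c z\<bar> * ?R z + \<bar>c z - c0\<bar> * B) \<longlongrightarrow> \<bar>c0\<bar> * 0 + \<bar>c0 - c0\<bar> * B) (at z0)"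
    by (intro tendsto_intros R c)
  have "((\<lambda>z. norm ((a z - a z0) * c z - (a z0 - a z0) * c z0 - c0 * a' (z - z0)) / norm (z - z0))
      \<longlongrightarrow> 0) (at z0)"
  proof (rule tendsto_sandwich[of "\<lambda>_. 0" _ _ "\<lambda>z. \<bar>c z\<bar> * ?R z + \<bar>c z - c0\<bar> * B"])
    have "norm ((a z - a z0) * c z - (a z0 - a z0) * c z0 - c0 * a' (z - z0)) / norm (z - z0)
        \<le> \<bar>c z\<bar> * ?R z + \<bar>c z - c0\<bar> * B" if "z \<noteq> z0" for z
    proof -
      have "(a z - a z0) * c z - (a z0 - a z0) * c z0 - c0 * a' (z - z0)
          = c z * (a z - a z0 - a' (z - z0)) + (c z - c0) * a' (z - z0)"
        by (simp add: algebra_simps)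
      also have "norm \<dots> \<le> \<bar>c z\<bar> * norm (a z - a z0 - a' (z - z0)) + \<bar>c z - c0\<bar> * (norm (z - z0) * B)"
        unfolding real_norm_def
        by (rule order_trans[OF abs_triangle_ineq])
          (use B[of "z - z0"] in \<open>auto simp: abs_mult intro!: add_mono mult_left_mono\<close>)
      finally show ?thesis
        using that by (simp add: field_simps)
    qed
    then show "\<forall>\<^sub>F z in at z0. norm ((a z - a z0) * c z - (a z0 - a z0) * c z0 - c0 * a' (z - z0)) / norm (z - z0)
        \<le> \<bar>c z\<bar> * ?R z + \<bar>c z - c0\<bar> * B"
      by (auto simp: eventually_at_filter)
  qed (use lim in auto)
  then show ?thesis
    using bl by (simp add: has_derivative_iff_norm bounded_linear_const_mult)
qed

text \<open>Only continuity of the partial derivatives is available, so the variables are switched one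
  at a time and each increment is expressed by the mean value theorem.\<close>

lemma has_derivative_finitely_many_vars:
  fixes h :: "'a::real_normed_vector \<Rightarrow> ('p, 'q) jet_var \<Rightarrow> real"
  assumes "finite S"
    and "\<And>v y. v \<in> S \<Longrightarrow> (\<lambda>s. f (y(v := s))) differentiable (at (y v))"
    and "\<And>v. v \<in> S \<Longrightarrow> continuous_on UNIV (pdiff v f)"
    and "\<And>v. v \<in> S \<Longrightarrow> ((\<lambda>z. h z v) has_derivative h' v) (at z0)"
    and "\<And>v z. v \<notin> S \<Longrightarrow> h z v = h z0 v"
  shows "((\<lambda>z. f (h z)) has_derivative (\<lambda>x. \<Sum>v\<in>S. pdiff v f (h z0) * h' v x)) (at z0)"
  using assms
proof (induction S arbitrary: h rule: finite_induct)
  case empty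
  have eq: "h z = h z0" for z
    by (intro ext empty.prems(4)) simp
  have "(\<lambda>z. f (h z)) = (\<lambda>z. f (h z0))"
    by (rule ext) (rule arg_cong[OF eq])
  then show ?case by simp
next
  case (insert v S)
  \<comment> \<open>Freezing the variable \<open>v\<close> at its value at \<open>z0\<close> leaves
    only the variables in \<open>S\<close> moving, so the induction hypothesis applies to
    \<open>k\<close>.\<close>
  define k where "k z = (h z)(v := h z0 v)" for z
  have k0: "k z0 = h z0" by (simp add: k_def)
  have IH: "((\<lambda>z. f (k z)) has_derivative (\<lambda>x. \<Sum>w\<in>S. pdiff w f (k z0) * h' w x)) (at z0)"
  proof (rule insert.IH)
    show "((\<lambda>z. k z w) has_derivative h' w) (at z0)" if "w \<in> S" for w
    proof -
      from that insert.hyps(2) have "w \<noteq> v" by blast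
      with that insert.prems(3)[of w] show ?thesis by (simp add: k_def)
    qed
    show "k z w = k z0 w" if "w \<notin> S" for w z
      using insert.prems(4)[of w z] that by (cases "w = v") (simp_all add: k_def)
  qed (use insert.prems(1,2) in auto)
  have D: "((\<lambda>s. f (y(v := s))) has_real_derivative pdiff v f (y(v := s))) (at s)" for y s
    using insert.prems(1)[OF insertI1, of "y(v := s)"]
    by (simp only: pdiff_def fun_upd_upd fun_upd_same DERIV_deriv_iff_real_differentiable)
  \<comment> \<open>The mean value point is chosen separately for each \<open>z\<close>, with no
    regularity in \<open>z\<close>. The bound on its distance from \<open>h z0 v\<close> alone
    forces its convergence.\<close>
  have "\<exists>\<xi>. \<bar>\<xi> - h z0 v\<bar> \<le> \<bar>h z v - h z0 v\<bar> \<and>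
      f (h z) - f (k z) = (h z v - h z0 v) * pdiff v f ((h z)(v := \<xi>))" for z
  proof -
    consider "h z v = h z0 v" | "h z0 v < h z v" | "h z v < h z0 v" by linarith
    then show ?thesis
    proof cases
      case 1
      then have "k z = h z" by (simp only: k_def 1[symmetric] fun_upd_triv)
      with 1 show ?thesis by (intro exI[of _ "h z v"]) simp
    next
      case 2
      from MVT2[OF 2 D[of "h z"]] obtain \<xi> where "h z0 v < \<xi>" "\<xi> < h z v"
        "f (h z) - f (k z) = (h z v - h z0 v) * pdiff v f ((h z)(v := \<xi>))"
        unfolding k_def fun_upd_triv by blast
      then show ?thesis
        by (intro exI[of _ \<xi>]) simp
    next
      case 3
      from MVT2[OF 3 D[of "h z"]] obtain \<xi> where "h z v < \<xi>" "\<xi> < h z0 v"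
        "f (k z) - f (h z) = (h z0 v - h z v) * pdiff v f ((h z)(v := \<xi>))"
        unfolding k_def fun_upd_triv by blast
      then show ?thesis
        by (intro exI[of _ \<xi>]) (simp add: algebra_simps)
    qed
  qed
  then obtain \<xi> where \<xi>: "\<And>z. \<bar>\<xi> z - h z0 v\<bar> \<le> \<bar>h z v - h z0 v\<bar>"
    "\<And>z. f (h z) - f (k z) = (h z v - h z0 v) * pdiff v f ((h z)(v := \<xi> z))"
    by metis
  have hc: "((\<lambda>z. h z w) \<longlongrightarrow> h z0 w) (at z0)" for w
  proof (cases "w \<in> insert v S")
    case True
    then show ?thesis
      using insert.prems(3) has_derivative_continuous unfolding continuous_within by blast
  next
    case False
    then have "(\<lambda>z. h z w) = (\<lambda>_. h z0 w)"
      using insert.prems(4) by blast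
    then show ?thesis by simp
  qed
  have "((\<lambda>z. \<xi> z - h z0 v) \<longlongrightarrow> 0) (at z0)"
  proof (rule Lim_null_comparison)
    show "\<forall>\<^sub>F z in at z0. norm (\<xi> z - h z0 v) \<le> \<bar>h z v - h z0 v\<bar>"
      using \<xi>(1) by simp
    show "((\<lambda>z. \<bar>h z v - h z0 v\<bar>) \<longlongrightarrow> 0) (at z0)"
      using hc[of v] by (simp add: LIM_zero_iff tendsto_rabs_zero_iff)
  qed
  then have "(\<xi> \<longlongrightarrow> h z0 v) (at z0)"
    by (simp add: LIM_zero_iff)
  then have "((\<lambda>z. (h z)(v := \<xi> z)) \<longlongrightarrow> h z0) (at z0)"
  proof (intro tendsto_fun_componentwise)
    fix w
    assume "(\<xi> \<longlongrightarrow> h z0 v) (at z0)"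
    then show "((\<lambda>z. ((h z)(v := \<xi> z)) w) \<longlongrightarrow> h z0 w) (at z0)"
      using hc[of w] by (cases "w = v") simp_all
  qed
  then have "((\<lambda>z. pdiff v f ((h z)(v := \<xi> z))) \<longlongrightarrow> pdiff v f (h z0)) (at z0)"
    using insert.prems(2)[of v]
    by (intro continuous_on_tendsto_compose[where f = "pdiff v f" and s = UNIV]) simp_all
  from has_derivative_increment_times[OF insert.prems(3)[of v] this]
  have "((\<lambda>z. f (h z) - f (k z)) has_derivative (\<lambda>x. pdiff v f (h z0) * h' v x)) (at z0)"
    by (simp add: \<xi>(2))
  from has_derivative_add[OF this IH] show ?case
    using insert.hyps by (simp add: k0)
qed

section \<open>Jet variables of bounded order\<close>

lemma finite_multi_indices: "finite {\<alpha> :: 'p::finite \<Rightarrow> nat. (\<Sum>k\<in>UNIV. \<alpha> k) \<le> n}"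
proof (rule finite_subset)
  show "{\<alpha> :: 'p \<Rightarrow> nat. (\<Sum>k\<in>UNIV. \<alpha> k) \<le> n} \<subseteq> (\<Pi>\<^sub>E k\<in>UNIV. {..n})"
  proof (intro subsetI PiE_I)
    fix \<alpha> :: "'p \<Rightarrow> nat" and k
    assume "\<alpha> \<in> {\<alpha>. (\<Sum>k\<in>UNIV. \<alpha> k) \<le> n}"
    moreover have "\<alpha> k \<le> (\<Sum>k\<in>UNIV. \<alpha> k)"
      by (rule member_le_sum) simp_all
    ultimately show "\<alpha> k \<in> {..n}"
      by simp
  qed simp
  show "finite (\<Pi>\<^sub>E k\<in>(UNIV :: 'p set). {..n})"
    by (intro finite_PiE) auto
qed

definition jet_vars :: "nat \<Rightarrow> ('p::finite, 'q) jet_var set" where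
  "jet_vars n = range Xvar \<union> (\<lambda>(j, \<alpha>). Uvar j \<alpha>) ` (UNIV \<times> {\<alpha>. (\<Sum>k\<in>UNIV. \<alpha> k) \<le> n})"

lemma finite_jet_vars: "finite (jet_vars n :: ('p::finite, 'q::finite) jet_var set)"
  by (simp add: jet_vars_def finite_multi_indices)

lemma of_order_leD:
  assumes "of_order_le n f" "\<And>v. v \<in> jet_vars n \<Longrightarrow> y v = y' v"
  shows "f y = f y'"
proof -
  have "y (Xvar k) = y' (Xvar k)" for k
    using assms(2) by (auto simp: jet_vars_def)
  moreover have "y (Uvar j \<alpha>) = y' (Uvar j \<alpha>)" if "(\<Sum>k\<in>UNIV. \<alpha> k) \<le> n" for j \<alpha>
    using assms(2) that by (force simp: jet_vars_def)
  ultimately show ?thesis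
    using assms(1) unfolding of_order_le_def by blast
qed

lemma of_order_leI:
  assumes "\<And>y y'. (\<And>v. v \<in> jet_vars n \<Longrightarrow> y v = y' v) \<Longrightarrow> f y = f y'"
  shows "of_order_le n f"
  unfolding of_order_le_def
proof (intro allI impI, elim conjE)
  fix y y' :: "('a, 'b) jet_var \<Rightarrow> real"
  assume x: "\<forall>k. y (Xvar k) = y' (Xvar k)"
    and u: "\<forall>j \<alpha>. (\<Sum>k\<in>UNIV. \<alpha> k) \<le> n \<longrightarrow> y (Uvar j \<alpha>) = y' (Uvar j \<alpha>)"
  show "f y = f y'"
  proof (rule assms)
    fix v :: "('a, 'b) jet_var"
    assume "v \<in> jet_vars n"
    then show "y v = y' v"
      using x u by (auto simp: jet_vars_def)
  qed
qed

lemma of_order_le_mono: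
  assumes "of_order_le m f" "m \<le> n"
  shows "of_order_le n f"
proof (rule of_order_leI)
  fix y y' :: "('a, 'b) jet_var \<Rightarrow> real"
  assume "\<And>v. v \<in> jet_vars n \<Longrightarrow> y v = y' v"
  moreover have "jet_vars m \<subseteq> jet_vars n"
    using assms(2) by (force simp: jet_vars_def)
  ultimately show "f y = f y'"
    using of_order_leD[OF assms(1)] by blast
qed

text \<open>The function is constant in such a variable. This is what makes the sums over all
  multi-indices finite.\<close>

lemma pdiff_eq_0:
  assumes "of_order_le n f" "v \<notin> jet_vars n"
  shows "pdiff v f = (\<lambda>_. 0)"
proof
  fix y
  have "(\<lambda>s. f (y(v := s))) = (\<lambda>_. f y)"
    by (intro ext of_order_leD[OF assms(1)]) (use assms(2) in auto)
  then show "pdiff v f y = 0"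
    by (simp add: pdiff_def)
qed

lemma of_order_le_pdiff:
  assumes "of_order_le n f"
  shows "of_order_le n (pdiff v f)"
\<comment> \<open>\<open>pdiff\<close> differentiates at the value \<open>y v\<close>, on which two
  points agreeing on \<open>jet_vars n\<close> are known to agree only if \<open>v\<close> belongs
  to that set. Otherwise the partial derivative is zero.\<close>
proof (cases "v \<in> jet_vars n")
  case True
  show ?thesis
  proof (rule of_order_leI)
    fix y y' :: "('a, 'b) jet_var \<Rightarrow> real"
    assume eq: "\<And>v. v \<in> jet_vars n \<Longrightarrow> y v = y' v"
    have "(\<lambda>s. f (y(v := s))) = (\<lambda>s. f (y'(v := s)))"
      using eq by (auto intro!: of_order_leD[OF assms])
    then show "pdiff v f y = pdiff v f y'"
      using eq[OF True] by (simp add: pdiff_def)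
  qed
next
  case False
  from pdiff_eq_0[OF assms this] show ?thesis
    by (simp add: of_order_le_def)
qed

lemma smooth_jetD:
  assumes "smooth_jet f"
  shows "continuous_on UNIV (foldr pdiff vs f)"
    and "(\<lambda>s. foldr pdiff vs f (y(v := s))) differentiable (at (y v))"
  using assms unfolding smooth_jet_def by blast+

lemma pdiff_space_A: "f \<in> space_A \<Longrightarrow> pdiff v f \<in> space_A"
proof -
  assume f: "f \<in> space_A"
  then have "smooth_jet f" by (simp add: space_A_def)
  \<comment> \<open>Appending \<open>v\<close> at the end of the list makes it the innermost, that
    is the first, differentiation.\<close>
  from smooth_jetD[OF this, of "_ @ [v]"] have "smooth_jet (pdiff v f)"
    unfolding smooth_jet_def by simp
  with f show ?thesis
    by (auto simp: space_A_def intro: of_order_le_pdiff)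
qed

section \<open>Smoothness of differential functions along a field\<close>

lemma smooth_funpow:
  fixes d :: "('a::real_normed_vector \<Rightarrow> real) \<Rightarrow> 'a \<Rightarrow> real"
  shows "(\<And>g. smooth g \<Longrightarrow> smooth (d g)) \<Longrightarrow> smooth f \<Longrightarrow> smooth ((d ^^ n) f)"
  by (induction n) auto

lemma smooth_ordered_diff:
  assumes "\<And>k g. smooth g \<Longrightarrow> smooth (d k g)" "smooth f"
  shows "smooth (ordered_diff d S \<alpha> f)"
proof -
  have "smooth (foldr (\<lambda>k. d k ^^ \<alpha> k) ks f)" for ks
    by (induction ks) (use assms in \<open>auto intro: smooth_funpow\<close>)
  then show ?thesis by (simp add: ordered_diff_def)
qed

lemma smooth_jet_component:
  assumes "smooth_fields u"
  shows "smooth (\<lambda>z. jet u z v)"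
proof (cases v)
  case (Xvar k)
  have "bounded_linear (\<lambda>z :: 'a spacetime. fst z $ k)"
    by (intro bounded_linear_compose[OF bounded_linear_vec_nth bounded_linear_fst])
  with Xvar show ?thesis
    by (simp add: jet_def smooth_bounded_linear)
next
  case (Uvar j \<alpha>)
  with assms show ?thesis
    by (simp add: jet_def smooth_fields_def smooth_ordered_diff smooth_dx)
qed

lemma has_derivative_along:
  assumes f: "f \<in> space_A" "of_order_le n f" and u: "smooth_fields u"
  shows "(along f u has_derivative (\<lambda>x. \<Sum>v\<in>jet_vars n.
      along (pdiff v f) u z * dir_deriv x (\<lambda>z. jet u z v) z)) (at z)"
proof -
  \<comment> \<open>The full jet has infinitely many moving coordinates. Those that \<open>f\<close>
    does not see are frozen at the arbitrary value 0, so that the chain rule for the finite set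
    \<open>jet_vars n\<close> applies.\<close>
  define h where "h z v = (if v \<in> jet_vars n then jet u z v else 0)" for z v
  have along: "along g u = (\<lambda>z. g (h z))" if "of_order_le n g" for g
    unfolding along_def
    by (intro ext of_order_leD[OF that]) (simp add: h_def)
  have "((\<lambda>z. f (h z)) has_derivative (\<lambda>x. \<Sum>v\<in>jet_vars n.
      pdiff v f (h z) * dir_deriv x (\<lambda>z. jet u z v) z)) (at z)"
  proof (rule has_derivative_finitely_many_vars[OF finite_jet_vars])
    fix v
    show "(\<lambda>s. f (y(v := s))) differentiable (at (y v))" for y
      using f(1) smooth_jetD(2)[of f "[]"] by (simp add: space_A_def)
    show "continuous_on UNIV (pdiff v f)"
      using f(1) smooth_jetD(1)[of f "[v]"] by (simp add: space_A_def)
    show "((\<lambda>z. h z v) has_derivative (\<lambda>x. dir_deriv x (\<lambda>z. jet u z v) z)) (at z)"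
      if "v \<in> jet_vars n"
      using that smooth_differentiable[OF smooth_jet_component[OF u]]
      by (simp add: h_def frechet_derivative_works)
    show "h z' v = h z v" if "v \<notin> jet_vars n" for z'
      using that by (simp add: h_def)
  qed
  then show ?thesis
    by (simp add: along f(2) of_order_le_pdiff)
qed

text \<open>The induction on the class runs over all of \<open>space_A\<close> at once: the chain
  rule writes a directional derivative of \<open>along f u\<close> as a sum of products of smooth
  jet derivatives with \<open>along (pdiff v f) u\<close>, and \<open>pdiff v f\<close> is again in
  \<open>space_A\<close>.\<close>

lemma smooth_along:
  assumes "f \<in> space_A" and u: "smooth_fields u"
  shows "smooth (along f u)"
proof -
  have "C_times m (along f u)" if "f \<in> space_A" for m and f :: "('a, 'b) jet_fun"
    using that
  proof (induction m arbitrary: f)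
    case 0
    then obtain n where "of_order_le n f" by (auto simp: space_A_def)
    from has_derivative_continuous[OF has_derivative_along[OF 0 this u]]
    show ?case by (simp add: continuous_at_imp_continuous_on)
  next
    case (Suc m)
    then obtain n where n: "of_order_le n f" by (auto simp: space_A_def)
    note D = has_derivative_along[OF Suc.prems n u]
    have "dir_deriv x (along f u) = (\<lambda>z. \<Sum>v\<in>jet_vars n.
        along (pdiff v f) u z * dir_deriv x (\<lambda>z. jet u z v) z)" for x
      by (rule ext) (simp only: frechet_derivative_at[OF D, symmetric])
    moreover have "C_times m (dir_deriv x (\<lambda>z. jet u z v))" for x v
      using smooth_dir_deriv[OF smooth_jet_component[OF u]] by (simp add: smooth_def)
    ultimately have "C_times m (dir_deriv x (along f u))" for x
      by (simp only:) (intro C_times_sum C_times_mult Suc.IH pdiff_space_A Suc.prems)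
    moreover have "along f u differentiable (at z)" for z
      using D differentiable_def by blast
    ultimately show ?case by simp
  qed
  with assms show ?thesis by (simp add: smooth_def)
qed


subsection \<open>The Lagrange identity\<close>

lemma funpow_commute:
  fixes d e :: "('a::real_normed_vector \<Rightarrow> real) \<Rightarrow> 'a \<Rightarrow> real"
  assumes "\<And>g. smooth g \<Longrightarrow> smooth (d g)" and "\<And>g. smooth g \<Longrightarrow> smooth (e g)"
    and "\<And>g. smooth g \<Longrightarrow> d (e g) = e (d g)" and f: "smooth f"
  shows "d ((e ^^ n) f) = (e ^^ n) (d f)"
proof (induction n)
  case (Suc n)
  then show ?case
    using assms(3)[OF smooth_funpow[OF assms(2) f]] by simp
qed simp

lemma ordered_diff_mdx_commute:
  assumes "smooth f"
  shows "mdx k (ordered_diff mdx S \<alpha> f) = ordered_diff mdx S \<alpha> (mdx k f)"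
proof -
  \<comment> \<open>Derivatives are known to commute only on smooth fields, so smoothness of the
    intermediate results is carried through the induction.\<close>
  have "mdx k (foldr (\<lambda>k. mdx k ^^ \<alpha> k) ks f) = foldr (\<lambda>k. mdx k ^^ \<alpha> k) ks (mdx k f) \<and>
      smooth (foldr (\<lambda>k. mdx k ^^ \<alpha> k) ks f)" for ks
  proof (induction ks)
    case (Cons l ks)
    then show ?case
      using funpow_commute[of "mdx k" "mdx l"]
      by (simp add: smooth_mdx mdx_commute smooth_funpow)
  qed (simp add: assms)
  then show ?thesis by (simp add: ordered_diff_def)
qed

text \<open>In \<open>flux\<close> the powers of \<open>mdx k\<close> stand innermost, while
  integration by parts in the variable \<open>k\<close> needs them outermost.\<close>

lemma ordered_diff_mdx_funpow:
  assumes "smooth f"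
  shows "ordered_diff mdx S \<alpha> ((mdx k ^^ n) f) = (mdx k ^^ n) (ordered_diff mdx S \<alpha> f)"
proof (induction n)
  case (Suc n)
  have "smooth ((mdx k ^^ n) f)"
    by (intro smooth_funpow smooth_mdx assms)
  from ordered_diff_mdx_commute[OF this] Suc show ?case
    by (metis comp_apply funpow.simps(2))
qed simp

text \<open>Operators are composed along the sorted list, so the largest index is applied first and
  the smallest last. Initial segments therefore grow on the inside and, in the companion lemma,
  final segments grow on the outside.\<close>

lemma ordered_diff_insert_max:
  assumes "\<And>l. l \<in> S \<Longrightarrow> l < k"
  shows "ordered_diff d (insert k S) \<alpha> f = ordered_diff d S \<alpha> ((d k ^^ \<alpha> k) f)"
proof -
  have "k \<notin> S" using assms[of k] by auto
  moreover have "insort k (sorted_list_of_set S) = sorted_list_of_set S @ [k]"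
    using assms by (intro sorted_insort_is_snoc) (auto intro: less_imp_le)
  ultimately show ?thesis
    by (simp add: ordered_diff_def)
qed

lemma ordered_diff_insert_min:
  assumes "\<And>l. l \<in> S \<Longrightarrow> k < l"
  shows "ordered_diff d (insert k S) \<alpha> f = (d k ^^ \<alpha> k) (ordered_diff d S \<alpha> f)"
proof -
  have "k \<notin> S" using assms[of k] by auto
  moreover have "insort k (sorted_list_of_set S) = k # sorted_list_of_set S"
    using assms by (intro insort_is_Cons) (auto intro: less_imp_le)
  ultimately show ?thesis
    by (simp add: ordered_diff_def)
qed

text \<open>By the product rule and the sign in \<open>mdx\<close>, the derivative of the summand
  for \<beta> is \<open>H \<beta> - H (Suc \<beta>)\<close>, where \<open>H\<close> carries \<beta>
  derivatives on \<open>f\<close> and the remaining ones on \<open>g\<close>. The sum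
  telescopes.\<close>

lemma dx_power_by_parts:
  assumes f: "smooth f" and g: "smooth g"
  shows "dx k (\<lambda>z. \<Sum>\<beta><m. (mdx k ^^ \<beta>) f z * (dx k ^^ (m - \<beta> - 1)) g z) z
      = f z * (dx k ^^ m) g z - (mdx k ^^ m) f z * g z"
proof -
  define H where "H \<beta> = (mdx k ^^ \<beta>) f z * (dx k ^^ (m - \<beta>)) g z" for \<beta>
  have sf: "smooth ((mdx k ^^ n) f)" for n
    by (intro smooth_funpow smooth_mdx f)
  have sg: "smooth ((dx k ^^ n) g)" for n
    by (intro smooth_funpow smooth_dx g)
  have "dx k (\<lambda>z. \<Sum>\<beta><m. (mdx k ^^ \<beta>) f z * (dx k ^^ (m - \<beta> - 1)) g z) z
      = (\<Sum>\<beta><m. dx k (\<lambda>z. (mdx k ^^ \<beta>) f z * (dx k ^^ (m - \<beta> - 1)) g z) z)"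
    by (intro dx_sum smooth_mult sf sg)
  also have "\<dots> = (\<Sum>\<beta><m. H \<beta> - H (Suc \<beta>))"
  proof (rule sum.cong)
    fix \<beta> assume "\<beta> \<in> {..<m}"
    \<comment> \<open>As \<beta> is below \<open>m\<close>, the natural subtraction is not
      truncated: the summand has \<open>n\<close> derivatives on \<open>g\<close>, and
      differentiating it restores \<open>Suc n\<close>, the exponent in
      \<open>H \<beta>\<close>.\<close>
    then obtain n where n: "m - \<beta> = Suc n" "m - Suc \<beta> = n"
      by (metis Suc_diff_Suc lessThan_iff)
    then show "dx k (\<lambda>z. (mdx k ^^ \<beta>) f z * (dx k ^^ (m - \<beta> - 1)) g z) z = H \<beta> - H (Suc \<beta>)"
      by (simp add: dx_mult sf sg H_def mdx_def)
  qed simp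
  also have "\<dots> = H 0 - H m"
    by (rule sum_lessThan_telescope')
  finally show ?thesis
    by (simp add: H_def)
qed

text \<open>In increasing order of the indices, the closed initial segment of one element is the
  open initial segment of the next.\<close>

lemma sum_telescope_initial_segments:
  fixes H :: "'k::{finite,linorder} set \<Rightarrow> real"
  shows "(\<Sum>k\<in>UNIV. H {..<k} - H {..k}) = H {} - H UNIV"
proof -
  \<comment> \<open>Taking the segments relative to an arbitrary \<open>A\<close> allows induction
    by adding a new maximum, which leaves the segments of the earlier elements unchanged.\<close>
  have "(\<Sum>k\<in>A. H {l \<in> A. l < k} - H {l \<in> A. l \<le> k}) = H {} - H A" for A
  proof (induction A rule: finite_linorder_max_induct[OF finite])
    case (2 b A)
    have less: "{l \<in> insert b A. l < k} = {l \<in> A. l < k}"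
      and le: "{l \<in> insert b A. l \<le> k} = {l \<in> A. l \<le> k}" if "k \<in> A" for k
      using that 2(2) by force+
    have b: "{l \<in> insert b A. l < b} = A" "{l \<in> insert b A. l \<le> b} = insert b A"
      using 2(2) by force+
    have "b \<notin> A" using 2(2) by auto
    then have "(\<Sum>k\<in>insert b A. H {l \<in> insert b A. l < k} - H {l \<in> insert b A. l \<le> k})
        = (H A - H (insert b A)) + (\<Sum>k\<in>A. H {l \<in> insert b A. l < k} - H {l \<in> insert b A. l \<le> k})"
      by (simp only: sum.insert[OF finite \<open>b \<notin> A\<close>] b)
    also have "\<dots> = (H A - H (insert b A)) + (\<Sum>k\<in>A. H {l \<in> A. l < k} - H {l \<in> A. l \<le> k})"
      by (simp only: less le cong: sum.cong)
    finally show ?case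
      using 2(3) by simp
  qed simp
  from this[of UNIV] show ?thesis
    by (simp add: lessThan_def atMost_def)
qed

text \<open>The contribution of a single triple \<open>i\<close>, \<open>j\<close>, \<alpha> to the
  flux component \<open>k\<close>, with \<open>f\<close> the coefficient \<rho>_i times the partial
  derivative of K_i and with \<open>g\<close> the component \<sigma>_j.\<close>

definition flux_term :: "('p::{finite,linorder} \<Rightarrow> nat) \<Rightarrow> 'p field \<Rightarrow> 'p field \<Rightarrow> 'p \<Rightarrow> 'p field" where
  "flux_term \<alpha> f g k = (\<lambda>z. \<Sum>\<beta><\<alpha> k. ordered_diff mdx {..<k} \<alpha> ((mdx k ^^ \<beta>) f) z *
     (dx k ^^ (\<alpha> k - \<beta> - 1)) (ordered_diff dx {k<..} \<alpha> g) z)"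

lemma smooth_flux_term:
  assumes "smooth f" "smooth g"
  shows "smooth (flux_term \<alpha> f g k)"
proof -
  have "smooth (ordered_diff mdx {..<k} \<alpha> ((mdx k ^^ m) f))" for m
    using smooth_mdx smooth_funpow[OF smooth_mdx assms(1)] by (rule smooth_ordered_diff)
  moreover have "smooth ((dx k ^^ m) (ordered_diff dx {k<..} \<alpha> g))" for m
    using smooth_dx smooth_ordered_diff[OF smooth_dx assms(2)] by (rule smooth_funpow)
  ultimately show ?thesis
    unfolding flux_term_def by (intro smooth_sum smooth_mult)
qed

text \<open>Writing \<open>H S = (-D)\<^sub>S f \<cdot> D\<^sub>-\<^sub>S g\<close>, the \<open>k\<close>-th divergence term moves the
  derivatives in \<open>x\<^sup>k\<close> from \<open>g\<close> to \<open>f\<close>, hence equals \<open>H {..<k} - H {..k}\<close>.\<close>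

lemma lagrange_identity:
  assumes f: "smooth f" and g: "smooth g"
  shows "(\<Sum>k\<in>UNIV. dx k (flux_term \<alpha> f g k) z) = f z * D_op \<alpha> g z - mD_op \<alpha> f z * g z"
proof -
  define H where "H S = ordered_diff mdx S \<alpha> f z * ordered_diff dx (- S) \<alpha> g z" for S
  have "dx k (flux_term \<alpha> f g k) z = H {..<k} - H {..k}" for k
  proof -
    let ?F = "ordered_diff mdx {..<k} \<alpha> f" and ?G = "ordered_diff dx {k<..} \<alpha> g"
    have "{..k} = insert k {..<k}" by auto
    then have F: "ordered_diff mdx {..k} \<alpha> f = (mdx k ^^ \<alpha> k) ?F"
      by (simp only: ordered_diff_insert_max[OF lessThan_iff[THEN iffD1]] ordered_diff_mdx_funpow[OF f])
    have "{k..} = insert k {k<..}" by auto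
    then have G: "ordered_diff dx {k..} \<alpha> g = (dx k ^^ \<alpha> k) ?G"
      by (simp only: ordered_diff_insert_min[OF greaterThan_iff[THEN iffD1]])
    have "smooth ?F" "smooth ?G"
      using f g by (simp_all add: smooth_ordered_diff smooth_mdx smooth_dx)
    from dx_power_by_parts[OF this] show ?thesis
      by (simp add: flux_term_def ordered_diff_mdx_funpow f H_def F G)
  qed
  then have "(\<Sum>k\<in>UNIV. dx k (flux_term \<alpha> f g k) z) = H {} - H UNIV"
    by (simp add: sum_telescope_initial_segments)
  then show ?thesis
    by (simp add: H_def ordered_diff_def)
qed


subsection \<open>The conservation law\<close>

lemma ordered_diff_zero:
  assumes "\<And>k. d k (\<lambda>_. 0) = (\<lambda>_. 0)"
  shows "ordered_diff d S \<alpha> (\<lambda>_. 0) = (\<lambda>_. 0)"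
proof -
  have "(d k ^^ n) (\<lambda>_. 0) = (\<lambda>_. 0)" for k n
    by (induction n) (use assms in simp_all)
  then have "foldr (\<lambda>k. d k ^^ \<alpha> k) ks (\<lambda>_. 0) = (\<lambda>_. 0)" for ks
    by (induction ks) simp_all
  then show ?thesis by (simp add: ordered_diff_def)
qed

lemma mdx_zero: "mdx k (\<lambda>_. 0) = (\<lambda>_. 0)"
proof
  fix z :: "'a spacetime"
  show "mdx k (\<lambda>_. 0) z = 0"
    by (cases z) (simp add: mdx_def dx_def)
qed

lemma flux_term_zero: "flux_term \<alpha> (\<lambda>_. 0) g k = (\<lambda>_. 0)"
proof -
  have "(mdx k ^^ n) (\<lambda>_. 0) = (\<lambda>_. 0)" for n
    by (induction n) (simp_all add: mdx_zero)
  then show ?thesis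
    by (simp add: flux_term_def ordered_diff_zero mdx_zero)
qed

text \<open>The support of the summand may vary with the point and the component; one fixed finite
  index set lets the sums be interchanged and differentiated termwise.\<close>

lemma Sum_any_multi_indices:
  fixes g :: "('p::finite \<Rightarrow> nat) \<Rightarrow> real"
  assumes "\<And>\<alpha>. \<not> (\<Sum>k\<in>UNIV. \<alpha> k) \<le> n \<Longrightarrow> g \<alpha> = 0"
  shows "Sum_any g = (\<Sum>\<alpha> | (\<Sum>k\<in>UNIV. \<alpha> k) \<le> n. g \<alpha>)"
  using assms by (intro Sum_any.expand_superset finite_multi_indices) auto

lemma common_order:
  fixes K :: "(('p::finite, 'q::finite) jet_fun) ^ 'r::finite"
  assumes "\<And>i. K $ i \<in> space_A"
  obtains n where "\<And>i. of_order_le n (K $ i)"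
proof -
  from assms have "\<exists>m. \<forall>i. of_order_le (m i) (K $ i)"
    by (intro choice) (auto simp: space_A_def)
  then obtain m where m: "\<And>i. of_order_le (m i) (K $ i)"
    by blast
  \<comment> \<open>The sum of the orders of all components serves as a common bound.\<close>
  have "m i \<le> (\<Sum>i\<in>UNIV. m i)" for i
    by (rule member_le_sum) simp_all
  with m show ?thesis
    using that of_order_le_mono by blast
qed

text \<open>An equality of functions and not of values at one point, because the adjoint and the
  flux differentiate the coefficient.\<close>

lemma along_pdiff_zero:
  assumes "of_order_le n f" "\<not> (\<Sum>k\<in>UNIV. \<alpha> k) \<le> n"
  shows "along (pdiff (Uvar j \<alpha>) f) u = (\<lambda>_. 0)"
proof -
  have "Uvar j \<alpha> \<notin> jet_vars n"
    using assms(2) by (auto simp: jet_vars_def)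
  from pdiff_eq_0[OF assms(1) this] show ?thesis
    by (simp add: along_def)
qed

lemma flux_eq:
  assumes "\<And>i. of_order_le n (K $ i)"
  shows "(flux K \<sigma> \<rho> $ k) u = (\<lambda>z. \<Sum>i\<in>UNIV. \<Sum>j\<in>UNIV. \<Sum>\<alpha> | (\<Sum>k\<in>UNIV. \<alpha> k) \<le> n.
    flux_term \<alpha> (\<lambda>z. (\<rho> $ i) u z * along (pdiff (Uvar j \<alpha>) (K $ i)) u z) ((\<sigma> $ j) u) k z)"
proof
  fix z
  have "(flux K \<sigma> \<rho> $ k) u z = (\<Sum>i\<in>UNIV. \<Sum>j\<in>UNIV. Sum_any (\<lambda>\<alpha>.
      flux_term \<alpha> (\<lambda>z. (\<rho> $ i) u z * along (pdiff (Uvar j \<alpha>) (K $ i)) u z) ((\<sigma> $ j) u) k z))"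
    by (simp add: flux_def flux_term_def)
  also have "\<dots> = (\<Sum>i\<in>UNIV. \<Sum>j\<in>UNIV. \<Sum>\<alpha> | (\<Sum>k\<in>UNIV. \<alpha> k) \<le> n.
      flux_term \<alpha> (\<lambda>z. (\<rho> $ i) u z * along (pdiff (Uvar j \<alpha>) (K $ i)) u z) ((\<sigma> $ j) u) k z)"
    by (intro sum.cong refl Sum_any_multi_indices)
      (simp add: along_pdiff_zero[OF assms] flux_term_zero)
  finally show "(flux K \<sigma> \<rho> $ k) u z = \<dots>" .
qed

lemma gateaux_eq:
  assumes "\<And>i. of_order_le n (K $ i)"
  shows "(apply_matrix (gateaux K u) w $ i) z = (\<Sum>j\<in>UNIV. \<Sum>\<alpha> | (\<Sum>k\<in>UNIV. \<alpha> k) \<le> n.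
    along (pdiff (Uvar j \<alpha>) (K $ i)) u z * D_op \<alpha> (w $ j) z)"
proof -
  have "(apply_matrix (gateaux K u) w $ i) z = (\<Sum>j\<in>UNIV. Sum_any (\<lambda>\<alpha>.
      along (pdiff (Uvar j \<alpha>) (K $ i)) u z * D_op \<alpha> (w $ j) z))"
    by (simp add: apply_matrix_def gateaux_def)
  also have "\<dots> = (\<Sum>j\<in>UNIV. \<Sum>\<alpha> | (\<Sum>k\<in>UNIV. \<alpha> k) \<le> n.
      along (pdiff (Uvar j \<alpha>) (K $ i)) u z * D_op \<alpha> (w $ j) z)"
    by (intro sum.cong refl Sum_any_multi_indices) (simp add: along_pdiff_zero[OF assms])
  finally show ?thesis .
qed

text \<open>The factors are swapped relative to \<open>gateaux_adjoint\<close>, so that the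
  differentiated coefficient is literally the one in \<open>flux\<close>.\<close>

lemma gateaux_adjoint_eq:
  assumes "\<And>i. of_order_le n (K $ i)"
  shows "(gateaux_adjoint K u w $ j) z = (\<Sum>i\<in>UNIV. \<Sum>\<alpha> | (\<Sum>k\<in>UNIV. \<alpha> k) \<le> n.
    mD_op \<alpha> (\<lambda>z. (w $ i) z * along (pdiff (Uvar j \<alpha>) (K $ i)) u z) z)"
proof -
  have "(gateaux_adjoint K u w $ j) z = (\<Sum>i\<in>UNIV. Sum_any (\<lambda>\<alpha>.
      mD_op \<alpha> (\<lambda>z. (w $ i) z * along (pdiff (Uvar j \<alpha>) (K $ i)) u z) z))"
    by (simp add: gateaux_adjoint_def mult.commute)
  also have "\<dots> = (\<Sum>i\<in>UNIV. \<Sum>\<alpha> | (\<Sum>k\<in>UNIV. \<alpha> k) \<le> n.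
      mD_op \<alpha> (\<lambda>z. (w $ i) z * along (pdiff (Uvar j \<alpha>) (K $ i)) u z) z)"
    by (intro sum.cong refl Sum_any_multi_indices)
      (simp add: along_pdiff_zero[OF assms] ordered_diff_zero mdx_zero)
  finally show ?thesis .
qed

theorem theorem3p1:
  fixes K :: "(('p::{finite,linorder}, 'q::finite) jet_fun) ^ 'q"
    and \<sigma> \<rho> :: "(('p, 'q) field_op) ^ 'q"
  assumes K: "\<And>i. K $ i \<in> space_A"
    and \<sigma>: "is_symmetry K \<sigma>"
    and \<rho>: "is_adjoint_symmetry K \<rho>"
  shows "(\<forall>u. solution K u \<longrightarrow>
            (\<forall>z. dt (inner_op \<sigma> \<rho> u) z = (\<Sum>k\<in>UNIV. dx k ((flux K \<sigma> \<rho> $ k) u) z))) \<and>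
         conserved_density K (inner_op \<sigma> \<rho>) \<and>
         (\<forall>k. flux K \<sigma> \<rho> $ k \<in> space_B) \<and>
         conserved_flux K (inner_op \<sigma> \<rho>) (flux K \<sigma> \<rho>)"
proof -
  let ?c = "\<lambda>u i j \<alpha>. along (pdiff (Uvar j \<alpha>) (K $ i)) u"
  let ?f = "\<lambda>u i j \<alpha> z. (\<rho> $ i) u z * ?c u i j \<alpha> z"
  obtain n where n: "\<And>i. of_order_le n (K $ i)"
    using common_order[OF K] by blast
  let ?A = "{\<alpha> :: 'p \<Rightarrow> nat. (\<Sum>k\<in>UNIV. \<alpha> k) \<le> n}"
  have \<sigma>B: "smooth ((\<sigma> $ i) u)" and \<rho>B: "smooth ((\<rho> $ i) u)" if "smooth_fields u" for i u
    using \<sigma> \<rho> that by (auto simp: is_symmetry_def is_adjoint_symmetry_def space_B_def)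
  have f: "smooth (?f u i j \<alpha>)" if "smooth_fields u" for u i j \<alpha>
    using that by (intro smooth_mult \<rho>B smooth_along pdiff_space_A K)
  have ft: "smooth (flux_term \<alpha> (?f u i j \<alpha>) ((\<sigma> $ j) u) k)" if "smooth_fields u" for u i j \<alpha> k
    using that by (intro smooth_flux_term f \<sigma>B)
  have T: "inner_op \<sigma> \<rho> \<in> space_B"
    unfolding space_B_def inner_op_def by (auto intro!: smooth_sum smooth_mult \<sigma>B \<rho>B)
  \<comment> \<open>Membership in \<open>space_B\<close> concerns every smooth \<open>u\<close>, so
    it is obtained from smoothness before any solution is fixed.\<close>
  have X: "flux K \<sigma> \<rho> $ k \<in> space_B" for k
    unfolding space_B_def flux_eq[OF n] by (auto intro!: smooth_sum ft)
  have law: "dt (inner_op \<sigma> \<rho> u) z = (\<Sum>k\<in>UNIV. dx k ((flux K \<sigma> \<rho> $ k) u) z)"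
    if sol: "solution K u" for u z
  proof -
    have u: "smooth_fields u"
      using sol by (simp add: solution_def)
    have \<sigma>t: "dt ((\<sigma> $ i) u) z = (\<Sum>j\<in>UNIV. \<Sum>\<alpha>\<in>?A. ?c u i j \<alpha> z * D_op \<alpha> ((\<sigma> $ j) u) z)" for i
    proof -
      have "dt ((\<sigma> $ i) u) z = (apply_matrix (gateaux K u) (values_at \<sigma> u) $ i) z"
        using \<sigma> sol unfolding is_symmetry_def by blast
      then show ?thesis
        by (simp add: gateaux_eq[OF n] values_at_def)
    qed
    have \<rho>t: "dt ((\<rho> $ j) u) z = - (\<Sum>i\<in>UNIV. \<Sum>\<alpha>\<in>?A. mD_op \<alpha> (?f u i j \<alpha>) z)" for j
    proof -
      have "dt ((\<rho> $ j) u) z = - (gateaux_adjoint K u (values_at \<rho> u) $ j) z"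
        using \<rho> sol unfolding is_adjoint_symmetry_def by blast
      then show ?thesis
        by (simp add: gateaux_adjoint_eq[OF n] values_at_def)
    qed
    have "dt (inner_op \<sigma> \<rho> u) z
        = (\<Sum>i\<in>UNIV. dt ((\<sigma> $ i) u) z * (\<rho> $ i) u z) + (\<Sum>j\<in>UNIV. (\<sigma> $ j) u z * dt ((\<rho> $ j) u) z)"
      unfolding inner_op_def using dt_inner[OF \<sigma>B \<rho>B, OF u u] by (simp add: sum.distrib)
    also have "(\<Sum>i\<in>UNIV. dt ((\<sigma> $ i) u) z * (\<rho> $ i) u z)
        = (\<Sum>i\<in>UNIV. \<Sum>j\<in>UNIV. \<Sum>\<alpha>\<in>?A. ?f u i j \<alpha> z * D_op \<alpha> ((\<sigma> $ j) u) z)"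
      by (simp add: \<sigma>t sum_distrib_left mult_ac)
    also have "(\<Sum>j\<in>UNIV. (\<sigma> $ j) u z * dt ((\<rho> $ j) u) z)
        = - (\<Sum>j\<in>UNIV. \<Sum>i\<in>UNIV. \<Sum>\<alpha>\<in>?A. mD_op \<alpha> (?f u i j \<alpha>) z * (\<sigma> $ j) u z)"
      by (simp add: \<rho>t sum_distrib_left sum_negf mult.commute)
    \<comment> \<open>The adjoint sums over the equations for each unknown \<open>j\<close>; the
      swap aligns its indices with those of the symmetry part, so that the two sums can be
      subtracted term by term.\<close>
    also have "(\<Sum>j\<in>UNIV. \<Sum>i\<in>UNIV. \<Sum>\<alpha>\<in>?A. mD_op \<alpha> (?f u i j \<alpha>) z * (\<sigma> $ j) u z)
        = (\<Sum>i\<in>UNIV. \<Sum>j\<in>UNIV. \<Sum>\<alpha>\<in>?A. mD_op \<alpha> (?f u i j \<alpha>) z * (\<sigma> $ j) u z)"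
      by (rule sum.swap)
    also have "(\<Sum>i\<in>UNIV. \<Sum>j\<in>UNIV. \<Sum>\<alpha>\<in>?A. ?f u i j \<alpha> z * D_op \<alpha> ((\<sigma> $ j) u) z) + - \<dots>
        = (\<Sum>i\<in>UNIV. \<Sum>j\<in>UNIV. \<Sum>\<alpha>\<in>?A.
            ?f u i j \<alpha> z * D_op \<alpha> ((\<sigma> $ j) u) z - mD_op \<alpha> (?f u i j \<alpha>) z * (\<sigma> $ j) u z)"
      by (simp only: sum_subtractf add_uminus_conv_diff)
    also have "\<dots> = (\<Sum>i\<in>UNIV. \<Sum>j\<in>UNIV. \<Sum>\<alpha>\<in>?A. \<Sum>k\<in>UNIV.
        dx k (flux_term \<alpha> (?f u i j \<alpha>) ((\<sigma> $ j) u) k) z)"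
      by (simp only: lagrange_identity[OF f[OF u] \<sigma>B[OF u]])
    \<comment> \<open>The sum over the spatial variables is moved past \<alpha>, \<open>j\<close>
      and \<open>i\<close>. Fixing the index sets in the swaps makes them go in this direction only;
      linearity of \<open>dx k\<close> then assembles the flux.\<close>
    also have "\<dots> = (\<Sum>k\<in>UNIV. \<Sum>i\<in>UNIV. \<Sum>j\<in>UNIV. \<Sum>\<alpha>\<in>?A.
        dx k (flux_term \<alpha> (?f u i j \<alpha>) ((\<sigma> $ j) u) k) z)"
      by (simp only: sum.swap[where A = ?A and B = "UNIV :: 'p set"]
          sum.swap[where A = "UNIV :: 'q set" and B = "UNIV :: 'p set"])
    also have "\<dots> = (\<Sum>k\<in>UNIV. dx k ((flux K \<sigma> \<rho> $ k) u) z)"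
      unfolding flux_eq[OF n] by (simp only: dx_sum smooth_sum ft[OF u])
    finally show ?thesis .
  qed
  have "conservation_law K (inner_op \<sigma> \<rho>) (flux K \<sigma> \<rho>)"
    using T X law by (simp add: conservation_law_def)
  with X law show ?thesis
    unfolding conserved_density_def conserved_flux_def by blast
qed

end
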